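(* Let $d\ge2$, $\beta>2$ and $\lambda\in(0,\infty)$ be fixed, and for $n_\Omega,n_\partial\in\mathbb N$ consider the squared contraction radius with logarithmic factors ignored, $$\widetilde R_{n_\Omega,n_\partial}^2=n_\Omega^{-\frac{2(\beta-2)}{d+2(\beta-2)}}+\lambda\,n_\partial^{-\frac{2\beta}{d-1+2\beta}} ,$$ whose first summand is the interior term and whose second summand is the boundary term. Put $$\kappa(d,\beta)=\frac{(\beta-2)(d-1+2\beta)}{\beta(d+2\beta-4)} .$$ Then the boundary term does not dominate the interior term whenever $n_\partial\gtrsim n_\Omega^{\kappa(d,\beta)}$: for every $c>0$ there is $C>0$ (depending only on $c,d,\beta,\lambda$) such that, for all $n_\Omega,n_\partial\in\mathbb N$ with $n_\partial\ge c\,n_\Omega^{\kappa(d,\beta)}$, $$\lambda\,n_\partial^{-\frac{2\beta}{d-1+2\beta}}\le C\,n_\Omega^{-\frac{2(\beta-2)}{d+2(\beta-2)}} .$$ In this regime the contraction radius is governed by the interior source observations, i.e. $\widetilde R_{n_\Omega,n_\partial}^2\asymp n_\Omega^{-\frac{2(\beta-2)}{d+2(\beta-2)}}$.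
   Context: Here $n_\Omega$ and $n_\partial$ are the numbers of noisy interior source observations and noisy boundary observations for a second-order elliptic Dirichlet problem on a $d$-dimensional domain with solution of Hölder smoothness $\beta$, and $\lambda$ is the boundary weight in the physics-informed loss. The full squared posterior contraction radius is $R_{n_\Omega,n_\partial}^2=n_\Omega^{-\frac{2(\beta-2)}{d+2(\beta-2)}}(\log n_\Omega)^{2\gamma}+\lambda n_\partial^{-\frac{2\beta}{d-1+2\beta}}(\log n_\partial)^{2\gamma}$ with $\gamma>2$; $\widetilde R^2$ is obtained by dropping the logarithmic factors. The notation $a\lesssim b$ means $a\le Cb$ with a constant $C$ independent of the sample sizes, and $a\asymp b$ means $a\lesssim b$ and $b\lesssim a$. *)

theory Defs
  imports Complex_Main
begin

text \<open>\<open>n\<^sub>\<Omega>\<close> counts the interior source observations, \<open>n\<^sub>b\<close> the boundary observations.\<close>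

definition interior_term :: "nat \<Rightarrow> real \<Rightarrow> nat \<Rightarrow> real" where
  "interior_term d \<beta> n\<^sub>\<Omega> =
     real n\<^sub>\<Omega> powr (- (2 * (\<beta> - 2) / (real d + 2 * (\<beta> - 2))))"

definition boundary_term :: "nat \<Rightarrow> real \<Rightarrow> real \<Rightarrow> nat \<Rightarrow> real" where
  "boundary_term d \<beta> l n\<^sub>b =
     l * real n\<^sub>b powr (- (2 * \<beta> / (real d - 1 + 2 * \<beta>)))"

text \<open>The squared contraction radius, logarithmic factors dropped; \<open>l\<close> is the boundary weight.\<close>

definition radius_sq :: "nat \<Rightarrow> real \<Rightarrow> real \<Rightarrow> nat \<Rightarrow> nat \<Rightarrow> real" where
  "radius_sq d \<beta> l n\<^sub>\<Omega> n\<^sub>b = interior_term d \<beta> n\<^sub>\<Omega> + boundary_term d \<beta> l n\<^sub>b"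

definition kappa :: "nat \<Rightarrow> real \<Rightarrow> real" where
  "kappa d \<beta> = ((\<beta> - 2) * (real d - 1 + 2 * \<beta>)) / (\<beta> * (real d + 2 * \<beta> - 4))"

text \<open>Sample sizes are positive: \<open>0 powr a = 0\<close> would make the rates meaningless at \<open>0\<close>.\<close>

definition regime :: "nat \<Rightarrow> real \<Rightarrow> real \<Rightarrow> (nat \<times> nat) set" where
  "regime d \<beta> c =
     {(n\<^sub>\<Omega>, n\<^sub>b). 1 \<le> n\<^sub>\<Omega> \<and> 1 \<le> n\<^sub>b \<and> real n\<^sub>b \<ge> c * real n\<^sub>\<Omega> powr kappa d \<beta>}"

text \<open>Non-asymptotic comparison up to a constant, uniform over all sample sizes in \<open>S\<close>.\<close>

definition lesssim_on :: "'a set \<Rightarrow> ('a \<Rightarrow> real) \<Rightarrow> ('a \<Rightarrow> real) \<Rightarrow> bool" where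
  "lesssim_on S f g \<longleftrightarrow> (\<exists>C>0. \<forall>x\<in>S. f x \<le> C * g x)"

definition same_order_on :: "'a set \<Rightarrow> ('a \<Rightarrow> real) \<Rightarrow> ('a \<Rightarrow> real) \<Rightarrow> bool" where
  "same_order_on S f g \<longleftrightarrow> lesssim_on S f g \<and> lesssim_on S g f"

end

theory Submission
  imports Defs
begin

text \<open>
  The exponent \<open>kappa d \<beta>\<close> is the quotient of the interior rate exponent by the boundary rate
  exponent (\<open>kappa_times_boundary_exponent\<close>), that is, the growth rate of the boundary sample
  at which the two rates coincide. The boundary rate decreases in the boundary sample size, so
  over the whole regime it is bounded by its value on the threshold curve
  \<open>n\<^sub>b = c * n\<^sub>\<Omega> powr kappa d \<beta>\<close>. There it is a multiple of the interior rate, with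
  factor \<open>l * c powr (- (2 * \<beta> / (d - 1 + 2 * \<beta>)))\<close>. The equivalence for the radius follows
  because the radius exceeds the interior rate by the boundary term, which is nonnegative.
\<close>

lemma powr_minus_le_of_powr_lower_bound:
  fixes b c k x y :: real
  assumes "c > 0" and "x > 0" and "b \<ge> 0" and "c * x powr k \<le> y"
  shows "y powr (- b) \<le> c powr (- b) * x powr (- (k * b))"
proof -
  have "y powr (- b) \<le> (c * x powr k) powr (- b)"
    using assms by (intro powr_mono2') auto
  also have "\<dots> = c powr (- b) * x powr (- (k * b))"
    using assms by (simp add: powr_mult powr_powr)
  finally show ?thesis .
qed

lemma kappa_times_boundary_exponent:
  assumes "d \<ge> 2" and "\<beta> > 2"
  shows "kappa d \<beta> * (2 * \<beta> / (real d - 1 + 2 * \<beta>)) = 2 * (\<beta> - 2) / (real d + 2 * (\<beta> - 2))"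
proof -
  define D E where "D = real d - 1 + 2 * \<beta>" and "E = real d + 2 * \<beta> - 4"
  have "D \<noteq> 0" "E \<noteq> 0" "\<beta> \<noteq> 0"
    using assms unfolding D_def E_def by linarith+
  then have "(\<beta> - 2) * D / (\<beta> * E) * (2 * \<beta> / D) = 2 * (\<beta> - 2) / E"
    by (simp add: divide_simps)
  moreover have "real d + 2 * (\<beta> - 2) = E"
    by (simp add: E_def)
  ultimately show ?thesis
    by (simp only: kappa_def flip: D_def E_def)
qed

lemma boundary_term_le_interior_term:
  assumes "d \<ge> 2" and "\<beta> > 2" and "l > 0" and "c > 0" and "(n\<^sub>\<Omega>, n\<^sub>b) \<in> regime d \<beta> c"
  shows "boundary_term d \<beta> l n\<^sub>b
       \<le> l * c powr (- (2 * \<beta> / (real d - 1 + 2 * \<beta>))) * interior_term d \<beta> n\<^sub>\<Omega>"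
proof -
  let ?b = "2 * \<beta> / (real d - 1 + 2 * \<beta>)"
  have "real n\<^sub>b powr (- ?b) \<le> c powr (- ?b) * real n\<^sub>\<Omega> powr (- (kappa d \<beta> * ?b))"
    using assms by (intro powr_minus_le_of_powr_lower_bound) (auto simp: regime_def)
  also have "\<dots> = c powr (- ?b) * interior_term d \<beta> n\<^sub>\<Omega>"
    by (simp only: kappa_times_boundary_exponent[OF assms(1,2)] interior_term_def)
  finally show ?thesis
    using \<open>l > 0\<close> by (simp add: boundary_term_def mult.assoc)
qed

theorem corollary4p6:
  fixes d :: nat and \<beta> l :: real
  assumes "d \<ge> 2" and "\<beta> > 2" and "l > 0"
  shows "(\<forall>c::real>0. \<exists>C>0. \<forall>(n\<^sub>\<Omega>, n\<^sub>b) \<in> regime d \<beta> c.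
            boundary_term d \<beta> l n\<^sub>b \<le> C * interior_term d \<beta> n\<^sub>\<Omega>)
       \<and> (\<forall>c::real>0. same_order_on (regime d \<beta> c)
            (\<lambda>(n\<^sub>\<Omega>, n\<^sub>b). radius_sq d \<beta> l n\<^sub>\<Omega> n\<^sub>b)
            (\<lambda>(n\<^sub>\<Omega>, n\<^sub>b). interior_term d \<beta> n\<^sub>\<Omega>))"
proof -
  have dominated: "\<exists>C>0. \<forall>(n\<^sub>\<Omega>, n\<^sub>b) \<in> regime d \<beta> c.
      boundary_term d \<beta> l n\<^sub>b \<le> C * interior_term d \<beta> n\<^sub>\<Omega>" if "c > 0" for c :: real
    using boundary_term_le_interior_term[OF assms that] assms that
    by (intro exI[of _ "l * c powr (- (2 * \<beta> / (real d - 1 + 2 * \<beta>)))"]) auto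
  moreover have "same_order_on (regime d \<beta> c)
      (\<lambda>(n\<^sub>\<Omega>, n\<^sub>b). radius_sq d \<beta> l n\<^sub>\<Omega> n\<^sub>b)
      (\<lambda>(n\<^sub>\<Omega>, n\<^sub>b). interior_term d \<beta> n\<^sub>\<Omega>)" if "c > 0" for c :: real
  proof -
    obtain C where "C > 0" and C: "\<forall>(n\<^sub>\<Omega>, n\<^sub>b) \<in> regime d \<beta> c.
        boundary_term d \<beta> l n\<^sub>b \<le> C * interior_term d \<beta> n\<^sub>\<Omega>"
      using dominated[OF \<open>c > 0\<close>] by blast
    have "lesssim_on (regime d \<beta> c)
        (\<lambda>(n\<^sub>\<Omega>, n\<^sub>b). radius_sq d \<beta> l n\<^sub>\<Omega> n\<^sub>b)
        (\<lambda>(n\<^sub>\<Omega>, n\<^sub>b). interior_term d \<beta> n\<^sub>\<Omega>)"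
      unfolding lesssim_on_def
      using \<open>C > 0\<close> C by (intro exI[of _ "1 + C"]) (auto simp: radius_sq_def distrib_right)
    moreover have "boundary_term d \<beta> l n\<^sub>b \<ge> 0" for n\<^sub>b
      using \<open>l > 0\<close> by (simp add: boundary_term_def)
    then have "lesssim_on (regime d \<beta> c)
        (\<lambda>(n\<^sub>\<Omega>, n\<^sub>b). interior_term d \<beta> n\<^sub>\<Omega>)
        (\<lambda>(n\<^sub>\<Omega>, n\<^sub>b). radius_sq d \<beta> l n\<^sub>\<Omega> n\<^sub>b)"
      unfolding lesssim_on_def by (intro exI[of _ 1]) (auto simp: radius_sq_def)
    ultimately show ?thesis
      by (simp add: same_order_on_def)
  qed
  ultimately show ?thesis
    by blast
qed

end
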